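(* Let $f$ and $g$ be real-valued functions defined on $\mathbb{T}^\kappa$ and $\mathbb{T}$, respectively. Fix $0<\alpha\le 1$ and put $\mu=1-\alpha$. Then $$\begin{aligned} \sum_{t=a}^{b-1}f(t)\,{}_a\Delta_t^\alpha g(t)={}&f(b-1)g(b)-f(a)g(a)+\sum_{t=a}^{b-2}\bigl({}_t\Delta_{\rho(b)}^\alpha f(t)\bigr)g^\sigma(t)\\ &+\frac{\mu}{\Gamma(\mu+1)}g(a)\left(\sum_{t=a}^{b-1}(t+\mu-a)^{(\mu-1)}f(t)-\sum_{t=\sigma(a)}^{b-1}(t+\mu-\sigma(a))^{(\mu-1)}f(t)\right). \end{aligned}$$
   Context: Let $a\in\mathbb{R}$ and $b=a+k$ with $k\in\mathbb{N}$, $k\ge 2$. Put $\mathbb{T}=\{a,a+1,\ldots,b\}$ and $\mathbb{T}^\kappa=\{a,\ldots,b-1\}$. Write $\sigma(t)=t+1$, $\rho(t)=t-1$, $g^\sigma(t)=g(t+1)$, $\Delta f(t)=f(t+1)-f(t)$, and $x^{(y)}=\Gamma(x+1)/\Gamma(x+1-y)$. Empty sums are $0$. All sums run over integer steps. Fractional sums of order $\nu\ge 0$: for a function $f$ on $\{a,\ldots,c\}$ with $c\in\{b-1,b\}$ and $t\in\{a,\ldots,c\}$, $${}_a\Delta_t^{-\nu}f(t)=f(t)+\frac{\nu}{\Gamma(\nu+1)}\sum_{s=a}^{t-1}(t+\nu-\sigma(s))^{(\nu-1)}f(s),$$ $${}_t\Delta_c^{-\nu}f(t)=f(t)+\frac{\nu}{\Gamma(\nu+1)}\sum_{s=t+1}^{c}(s+\nu-\sigma(t))^{(\nu-1)}f(s)$$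 (so for $\nu=0$ both equal $f(t)$). Fractional differences of order $\alpha\in(0,1]$, with $\mu=1-\alpha$: for $t\in\{a,\ldots,c-1\}$, ${}_a\Delta_t^\alpha f(t)=\Delta({}_a\Delta_t^{-\mu}f(t))$ and ${}_t\Delta_c^\alpha f(t)=-\Delta({}_t\Delta_c^{-\mu}f(t))$, where the outer forward difference $\Delta$ acts in the variable $t$. *)

theory Defs
  imports "HOL-Analysis.Gamma_Function"
begin

text \<open>
  Functions on a finite unit-step grid are represented by total functions on the reals; every
  sum and difference below evaluates them at grid points only, so the values elsewhere are
  irrelevant.
\<close>

text \<open>The points p, p + 1, ..., q, for q - p an integer; the set is empty when q < p.\<close>

definition grid :: "real \<Rightarrow> real \<Rightarrow> real set" where
  "grid p q = {s. s \<le> q \<and> (\<exists>i::nat. s = p + real i)}"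

definition sigma_jump :: "real \<Rightarrow> real" where
  "sigma_jump t = t + 1"

definition rho_jump :: "real \<Rightarrow> real" where
  "rho_jump t = t - 1"

definition fdiff :: "(real \<Rightarrow> real) \<Rightarrow> real \<Rightarrow> real" where
  "fdiff f t = f (t + 1) - f t"

text \<open>
  The power \<open>x\<^sup>(\<^sup>y\<^sup>)\<close>. In the fractional sums below both Gamma arguments are positive, so the
  library's value of Gamma at its poles plays no role.
\<close>

definition fpow :: "real \<Rightarrow> real \<Rightarrow> real" where
  "fpow x y = Gamma (x + 1) / Gamma (x + 1 - y)"

text \<open>The left and right fractional sums of order \<open>\<nu> \<ge> 0\<close>, with base point a resp. c.\<close>

definition left_frac_sum :: "real \<Rightarrow> real \<Rightarrow> (real \<Rightarrow> real) \<Rightarrow> real \<Rightarrow> real" where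
  "left_frac_sum a \<nu> f t =
     f t + \<nu> / Gamma (\<nu> + 1) * (\<Sum>s\<in>grid a (t - 1). fpow (t + \<nu> - sigma_jump s) (\<nu> - 1) * f s)"

definition right_frac_sum :: "real \<Rightarrow> real \<Rightarrow> (real \<Rightarrow> real) \<Rightarrow> real \<Rightarrow> real" where
  "right_frac_sum c \<nu> f t =
     f t + \<nu> / Gamma (\<nu> + 1) * (\<Sum>s\<in>grid (t + 1) c. fpow (s + \<nu> - sigma_jump t) (\<nu> - 1) * f s)"

text \<open>The left and right fractional differences of order \<open>0 < \<alpha> \<le> 1\<close>.\<close>

definition left_frac_diff :: "real \<Rightarrow> real \<Rightarrow> (real \<Rightarrow> real) \<Rightarrow> real \<Rightarrow> real" where
  "left_frac_diff a \<alpha> f t = fdiff (left_frac_sum a (1 - \<alpha>) f) t"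

definition right_frac_diff :: "real \<Rightarrow> real \<Rightarrow> (real \<Rightarrow> real) \<Rightarrow> real \<Rightarrow> real" where
  "right_frac_diff c \<alpha> f t = - fdiff (right_frac_sum c (1 - \<alpha>) f) t"

end

theory Submission imports Defs begin

text \<open>
  With \<open>F i = f (a + i)\<close> and \<open>G i = g (a + i)\<close>, the left difference of \<open>g\<close> at index \<open>i\<close> is the
  forward difference of \<open>G\<close> plus \<open>c \<Sum>\<^sub>j K i j G j\<close>, where \<open>K\<close> is the forward difference in \<open>i\<close>
  of the fractional kernel, truncated below the diagonal, and \<open>c = \<mu> / \<Gamma>(\<mu> + 1)\<close>. The kernel
  depends only on \<open>i - j\<close>, so the right difference of \<open>f\<close> at index \<open>j - 1\<close> is
  \<open>F (j - 1) - F j\<close> plus \<open>c\<close> times the transpose of \<open>K\<close> applied to \<open>F\<close>. Hence the formula is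
  ordinary summation by parts together with an exchange of a finite double sum; the column
  \<open>j = 0\<close>, which no right difference covers, is the boundary term carrying \<open>g a\<close>.
\<close>

lemma grid_eq_image:
  "grid (a + real m) (a + real n - 1) = (\<lambda>i. a + real i) ` {m..<n}"
proof (intro equalityI subsetI)
  fix s assume "s \<in> grid (a + real m) (a + real n - 1)"
  then obtain i where "s = a + real (m + i)" "real (m + i) \<le> real n - 1"
    by (auto simp: grid_def)
  then show "s \<in> (\<lambda>i. a + real i) ` {m..<n}"
    by (intro image_eqI[of _ _ "m + i"]) auto
next
  fix s assume "s \<in> (\<lambda>i. a + real i) ` {m..<n}"
  then obtain i where "s = a + real i" "m \<le> i" "i < n" by auto
  then show "s \<in> grid (a + real m) (a + real n - 1)"
    by (auto simp: grid_def intro!: exI[of _ "i - m"])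
qed

text \<open>The exclusive upper index \<open>n\<close> lets \<open>n = 0\<close> or
  \<open>n \<le> m\<close> give the empty grid without truncated subtraction.\<close>

lemma sum_grid:
  assumes "p = a + real m" "q = a + real n - 1"
  shows "sum h (grid p q) = (\<Sum>i=m..<n. h (a + real i))"
  unfolding assms grid_eq_image by (subst sum.reindex) (auto simp: inj_on_def)

text \<open>Here \<open>d\<close> is the distance between the points of evaluation and summation,
  the same in left and right sums. The value is Gamma(d + \<nu>) / d!; for \<nu> > 0, multiplied by
  \<nu> / Gamma(\<nu> + 1), it is the coefficient of z^d in (1 - z)^(-\<nu>).\<close>

definition frac_kernel :: "real \<Rightarrow> nat \<Rightarrow> real" where
  "frac_kernel \<nu> d = fpow (real d + \<nu> - 1) (\<nu> - 1)"

text \<open>On the diagonal only the first term survives: the distance 0 contribution is the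
  separate summand \<open>f t\<close> of a fractional sum.\<close>

definition diff_kernel :: "real \<Rightarrow> nat \<Rightarrow> nat \<Rightarrow> real" where
  "diff_kernel \<nu> i j =
     (if j \<le> i then frac_kernel \<nu> (Suc i - j) else 0) - (if j < i then frac_kernel \<nu> (i - j) else 0)"

text \<open>Padding with zeros gives all points the same summation range, so that sums at
  neighbouring points subtract termwise and the later double sum runs over a square.\<close>

lemma left_frac_sum_eq:
  assumes "i \<le> n"
  shows "left_frac_sum a \<nu> g (a + real i) = g (a + real i) +
    \<nu> / Gamma (\<nu> + 1) * (\<Sum>j<n. (if j < i then frac_kernel \<nu> (i - j) else 0) * g (a + real j))"
proof -
  have "(\<Sum>s\<in>grid a (a + real i - 1). fpow (a + real i + \<nu> - sigma_jump s) (\<nu> - 1) * g s)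
      = (\<Sum>j=0..<i. fpow (a + real i + \<nu> - sigma_jump (a + real j)) (\<nu> - 1) * g (a + real j))"
    by (rule sum_grid) auto
  also have "\<dots> = (\<Sum>j<n. (if j < i then frac_kernel \<nu> (i - j) else 0) * g (a + real j))"
    using assms
    by (intro sum.mono_neutral_cong_left)
       (auto simp: frac_kernel_def sigma_jump_def of_nat_diff algebra_simps)
  finally show ?thesis by (simp add: left_frac_sum_def)
qed

lemma right_frac_sum_eq:
  "right_frac_sum (a + real n - 1) \<nu> f (a + real i) = f (a + real i) +
    \<nu> / Gamma (\<nu> + 1) * (\<Sum>j<n. (if i < j then frac_kernel \<nu> (j - i) else 0) * f (a + real j))"
proof -
  have "(\<Sum>s\<in>grid (a + real i + 1) (a + real n - 1).
          fpow (s + \<nu> - sigma_jump (a + real i)) (\<nu> - 1) * f s)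
      = (\<Sum>j=Suc i..<n. fpow (a + real j + \<nu> - sigma_jump (a + real i)) (\<nu> - 1) * f (a + real j))"
    by (rule sum_grid) auto
  also have "\<dots> = (\<Sum>j<n. (if i < j then frac_kernel \<nu> (j - i) else 0) * f (a + real j))"
    by (intro sum.mono_neutral_cong_left)
       (auto simp: frac_kernel_def sigma_jump_def of_nat_diff algebra_simps)
  finally show ?thesis by (simp add: right_frac_sum_def)
qed

lemma left_frac_diff_eq:
  assumes "i < n"
  shows "left_frac_diff a (1 - \<nu>) g (a + real i) = g (a + real (Suc i)) - g (a + real i) +
    \<nu> / Gamma (\<nu> + 1) * (\<Sum>j<n. diff_kernel \<nu> i j * g (a + real j))"
proof -
  have "left_frac_diff a (1 - \<nu>) g (a + real i)
      = left_frac_sum a \<nu> g (a + real (Suc i)) - left_frac_sum a \<nu> g (a + real i)"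
    by (simp add: left_frac_diff_def fdiff_def add_ac)
  moreover have "(\<Sum>j<n. diff_kernel \<nu> i j * g (a + real j))
      = (\<Sum>j<n. (if j < Suc i then frac_kernel \<nu> (Suc i - j) else 0) * g (a + real j))
      - (\<Sum>j<n. (if j < i then frac_kernel \<nu> (i - j) else 0) * g (a + real j))"
    by (simp only: diff_kernel_def left_diff_distrib sum_subtractf less_Suc_eq_le)
  ultimately show ?thesis
    using assms by (simp only: left_frac_sum_eq[of _ n] Suc_le_eq less_imp_le right_diff_distrib)
qed

text \<open>The column is \<open>Suc i\<close> because the sum at index \<open>i\<close> runs over
  \<open>j\<close> with \<open>Suc i \<le> j\<close>, at distance
  \<open>j - i = Suc j - Suc i\<close>.\<close>

lemma right_frac_diff_eq:
  "right_frac_diff (a + real n - 1) (1 - \<nu>) f (a + real i) =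
    f (a + real i) - f (a + real (Suc i)) +
    \<nu> / Gamma (\<nu> + 1) * (\<Sum>j<n. diff_kernel \<nu> j (Suc i) * f (a + real j))"
proof -
  have "right_frac_diff (a + real n - 1) (1 - \<nu>) f (a + real i)
      = right_frac_sum (a + real n - 1) \<nu> f (a + real i)
      - right_frac_sum (a + real n - 1) \<nu> f (a + real (Suc i))"
    by (simp add: right_frac_diff_def fdiff_def add_ac)
  moreover have "(\<Sum>j<n. diff_kernel \<nu> j (Suc i) * f (a + real j))
      = (\<Sum>j<n. (if i < j then frac_kernel \<nu> (j - i) else 0) * f (a + real j))
      - (\<Sum>j<n. (if Suc i < j then frac_kernel \<nu> (j - Suc i) else 0) * f (a + real j))"
    by (simp only: diff_kernel_def left_diff_distrib sum_subtractf Suc_le_eq diff_Suc_Suc)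
  ultimately show ?thesis
    by (simp only: right_frac_sum_eq right_diff_distrib)
qed

text \<open>\<open>F\<close> is read only up to \<open>m\<close> but \<open>G\<close> up to
  \<open>Suc m\<close>, matching the domains of \<open>f\<close> and \<open>g\<close>.\<close>

lemma sum_by_parts:
  fixes F G :: "nat \<Rightarrow> 'a::comm_ring"
  shows "(\<Sum>i<Suc m. F i * (G (Suc i) - G i)) =
    F m * G (Suc m) - F 0 * G 0 + (\<Sum>i<m. (F i - F (Suc i)) * G (Suc i))"
  by (induction m) (simp_all add: algebra_simps)

lemma sum_by_parts_kernel:
  fixes F G :: "nat \<Rightarrow> 'a::comm_ring" and K :: "nat \<Rightarrow> nat \<Rightarrow> 'a"
  shows "(\<Sum>i<Suc m. F i * (G (Suc i) - G i + c * (\<Sum>j<Suc m. K i j * G j))) =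
    F m * G (Suc m) - F 0 * G 0
    + (\<Sum>i<m. (F i - F (Suc i) + c * (\<Sum>j<Suc m. K j (Suc i) * F j)) * G (Suc i))
    + c * G 0 * (\<Sum>j<Suc m. K j 0 * F j)"
proof -
  have "(\<Sum>i<Suc m. F i * (c * (\<Sum>j<Suc m. K i j * G j)))
      = (\<Sum>i<Suc m. \<Sum>j<Suc m. c * (K i j * F i) * G j)"
    by (simp only: sum_distrib_left ac_simps)
  also have "\<dots> = (\<Sum>j<Suc m. \<Sum>i<Suc m. c * (K i j * F i) * G j)"
    by (rule sum.swap)
  also have "\<dots> = (\<Sum>j<Suc m. c * (\<Sum>i<Suc m. K i j * F i) * G j)"
    by (simp only: sum_distrib_left sum_distrib_right)
  \<comment> \<open>Column 0 is split off because the remaining sum by parts involves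
    \<open>G\<close> only at successors.\<close>
  also have "\<dots> = c * G 0 * (\<Sum>i<Suc m. K i 0 * F i)
      + (\<Sum>j<m. c * (\<Sum>i<Suc m. K i (Suc j) * F i) * G (Suc j))"
    by (subst sum.lessThan_Suc_shift) (simp only: ac_simps)
  finally show ?thesis
    by (simp only: distrib_left distrib_right sum.distrib sum_by_parts) (simp only: ac_simps)
qed

lemma sum_diff_kernel_0:
  "(\<Sum>t\<in>grid a (a + real n - 1). fpow (t + \<mu> - a) (\<mu> - 1) * f t)
   - (\<Sum>t\<in>grid (sigma_jump a) (a + real n - 1). fpow (t + \<mu> - sigma_jump a) (\<mu> - 1) * f t)
   = (\<Sum>j<n. diff_kernel \<mu> j 0 * f (a + real j))"
proof -
  have "(\<Sum>t\<in>grid a (a + real n - 1). fpow (t + \<mu> - a) (\<mu> - 1) * f t)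
      = (\<Sum>j=0..<n. fpow (a + real j + \<mu> - a) (\<mu> - 1) * f (a + real j))"
    by (rule sum_grid) auto
  \<comment> \<open>The vacuous test and the \<open>- 0\<close> keep the literal shape of
    \<open>diff_kernel\<close> at column 0, for the final rewriting.\<close>
  also have "\<dots> = (\<Sum>j<n. (if 0 \<le> j then frac_kernel \<mu> (Suc j - 0) else 0) * f (a + real j))"
    by (intro sum.cong) (auto simp: frac_kernel_def algebra_simps)
  finally have 1: "(\<Sum>t\<in>grid a (a + real n - 1). fpow (t + \<mu> - a) (\<mu> - 1) * f t) = \<dots>" .
  have "(\<Sum>t\<in>grid (sigma_jump a) (a + real n - 1). fpow (t + \<mu> - sigma_jump a) (\<mu> - 1) * f t)
      = (\<Sum>j=1..<n. fpow (a + real j + \<mu> - sigma_jump a) (\<mu> - 1) * f (a + real j))"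
    by (rule sum_grid) (auto simp: sigma_jump_def)
  also have "\<dots> = (\<Sum>j<n. (if 0 < j then frac_kernel \<mu> (j - 0) else 0) * f (a + real j))"
    by (intro sum.mono_neutral_cong_left)
       (auto simp: frac_kernel_def sigma_jump_def algebra_simps)
  finally show ?thesis
    by (simp only: 1 diff_kernel_def left_diff_distrib sum_subtractf)
qed

theorem theorem3p2:
  fixes a b \<alpha> \<mu> :: real and k :: nat and f g :: "real \<Rightarrow> real"
  assumes "k \<ge> 2" and "b = a + real k"
    and "0 < \<alpha>" and "\<alpha> \<le> 1" and "\<mu> = 1 - \<alpha>"
  shows "(\<Sum>t\<in>grid a (b - 1). f t * left_frac_diff a \<alpha> g t) =
      f (b - 1) * g b - f a * g a
      + (\<Sum>t\<in>grid a (b - 2). right_frac_diff (rho_jump b) \<alpha> f t * g (sigma_jump t))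
      + \<mu> / Gamma (\<mu> + 1) * g a *
        ((\<Sum>t\<in>grid a (b - 1). fpow (t + \<mu> - a) (\<mu> - 1) * f t)
         - (\<Sum>t\<in>grid (sigma_jump a) (b - 1). fpow (t + \<mu> - sigma_jump a) (\<mu> - 1) * f t))"
proof -
  obtain m where k: "k = Suc m" using assms(1) by (cases k) auto
  have \<alpha>: "\<alpha> = 1 - \<mu>" using assms by simp
  have b: "b = a + real (Suc m)" using assms k by simp
  let ?F = "\<lambda>i. f (a + real i)" and ?G = "\<lambda>i. g (a + real i)"
  let ?c = "\<mu> / Gamma (\<mu> + 1)"
  have "(\<Sum>t\<in>grid a (b - 1). f t * left_frac_diff a \<alpha> g t)
      = (\<Sum>i=0..<Suc m. ?F i * left_frac_diff a \<alpha> g (a + real i))"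
    by (rule sum_grid) (auto simp: b)
  also have "\<dots> = (\<Sum>i<Suc m. ?F i *
      (?G (Suc i) - ?G i + ?c * (\<Sum>j<Suc m. diff_kernel \<mu> i j * ?G j)))"
    unfolding \<alpha> by (intro sum.cong) (auto simp only: left_frac_diff_eq atLeast0LessThan lessThan_iff)
  also have "\<dots> = ?F m * ?G (Suc m) - ?F 0 * ?G 0
      + (\<Sum>i<m. (?F i - ?F (Suc i) + ?c * (\<Sum>j<Suc m. diff_kernel \<mu> j (Suc i) * ?F j)) * ?G (Suc i))
      + ?c * ?G 0 * (\<Sum>j<Suc m. diff_kernel \<mu> j 0 * ?F j)"
    by (rule sum_by_parts_kernel)
  \<comment> \<open>The right base point \<open>rho_jump b\<close> is
    \<open>a + real (Suc m) - 1\<close>, so the inner sums have length \<open>Suc m\<close>, while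
    the outer grid ends at \<open>b - 2 = a + real m - 1\<close>.\<close>
  also have "(\<Sum>i<m. (?F i - ?F (Suc i) + ?c * (\<Sum>j<Suc m. diff_kernel \<mu> j (Suc i) * ?F j)) * ?G (Suc i))
      = (\<Sum>i=0..<m. right_frac_diff (rho_jump b) \<alpha> f (a + real i) * g (sigma_jump (a + real i)))"
    unfolding \<alpha> b rho_jump_def right_frac_diff_eq
    by (intro sum.cong) (auto simp: sigma_jump_def add_ac)
  also have "\<dots> = (\<Sum>t\<in>grid a (b - 2). right_frac_diff (rho_jump b) \<alpha> f t * g (sigma_jump t))"
    by (rule sum_grid[symmetric]) (auto simp: b)
  also have "(\<Sum>j<Suc m. diff_kernel \<mu> j 0 * ?F j)
      = (\<Sum>t\<in>grid a (b - 1). fpow (t + \<mu> - a) (\<mu> - 1) * f t)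
         - (\<Sum>t\<in>grid (sigma_jump a) (b - 1). fpow (t + \<mu> - sigma_jump a) (\<mu> - 1) * f t)"
    unfolding b by (rule sum_diff_kernel_0[symmetric])
  finally show ?thesis by (simp add: b)
qed

end
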